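(* Let $S=(s_{ij})$ be a fixed routing table. For the queueing network described in the context, with the deterministic routing procedure defined by $S$, every $\alpha_{ij}$, $\beta_{ij}$, and $\delta_{ij}$ ($i=1,\dots,L$; $j=1,2,\dots$) is represented as a function of the service times $\tau\in\mathbf T$, using the operations $\max$, $\min$ and $+$, provided that its associated service occurs.
   Context: The network has $L$ single-server nodes, each with a server and an infinite-capacity buffer. At the initial time all servers are free and there are $n_i$ ($0\le n_i\le\infty$) customers in the buffer of node $i$, $i=1,\dots,L$. All customers are of a single class. A customer arriving at a node occupies the server if it is free; otherwise the customer joins the queue and is placed into the buffer. Queued customers are served in first-come, first-served order. The set of service times is $\mathbf T=\{\tau_{ij}\}$, where $\tau_{ij}=\tau_{ij}(\theta,\omega)$ is the service time of the customer who is the $j$th to initiate a service at node $i$; these are given random variables depending on decision parameters $\theta\in\Theta\subset\mathbb R^n$ and a random vector $\omega$. A routing table is a matrix $S=(s_{ij})$, $i=1,\dots,L$, $j=1,2,\dots$, with $s_{ij}\in\{1,\dots,L\}$. With the deterministic routing procedure defined by $S$, the customer who is the $j$th to depart from node $i$ (upon completing service there) goes to node $s_{ij}$ and arrives there immediately ($s_{ij}=i$ is allowed). For node $i$, $\alpha_{ij}$ is the time of the $j$th arrival into the node (if $n_i>0$, the initial customers count as the first arrivals, so $\alpha_{i1}=\dots=\alpha_{in_i}=0$), $\beta_{ij}$ is the time of the $j$th initiation of a service, and $\delta_{ij}$ is the time of the $j$th departure from the node. They satisfy $$\delta_{ij}=\beta_{ij}+\tau_{ij},\qquad \beta_{ij}=\max\{\alpha_{ij},\delta_{i,j-1}\},\qquad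 j=1,2,\dots,\quad \delta_{i0}\equiv 0.$$ *)

theory Defs
  imports "HOL-Probability.Probability"
begin

text \<open>
  The \<open>L\<close> nodes are the elements of a finite type \<open>'l\<close>. Customers and events at a node are
  counted from 1; the index 0 occurs only in the convention \<open>\<delta> i 0 = 0\<close>.
  The value \<open>\<infinity>\<close> of an event time means that the event never occurs.
\<close>

definition ecard :: "'a set \<Rightarrow> enat" where
  "ecard A = (if finite A then enat (card A) else \<infinity>)"

definition routed :: "('l \<Rightarrow> nat \<Rightarrow> 'l) \<Rightarrow> 'l \<Rightarrow> ('l \<times> nat) set" where
  "routed S i = {(k, m). 1 \<le> m \<and> S k m = i}"

definition arrivals ::
  "('l \<Rightarrow> enat) \<Rightarrow> ('l \<Rightarrow> nat \<Rightarrow> 'l) \<Rightarrow> ('l \<Rightarrow> nat \<Rightarrow> ereal) \<Rightarrow> 'l \<Rightarrow> real \<Rightarrow> enat" where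
  "arrivals n S \<delta> i t = n i + ecard {(k, m) \<in> routed S i. \<delta> k m \<le> ereal t}"

locale queueing_equations =
  fixes n :: "'l::finite \<Rightarrow> enat"
    and S :: "'l \<Rightarrow> nat \<Rightarrow> 'l"
    and \<tau> :: "'l \<Rightarrow> nat \<Rightarrow> real"
    and \<alpha> \<beta> \<delta> :: "'l \<Rightarrow> nat \<Rightarrow> ereal"
  assumes service_nonneg: "1 \<le> j \<Longrightarrow> 0 \<le> \<tau> i j"
    and arrival: "1 \<le> j \<Longrightarrow> \<alpha> i j = Inf {ereal t |t. 0 \<le> t \<and> enat j \<le> arrivals n S \<delta> i t}"
    and initiation: "1 \<le> j \<Longrightarrow> \<beta> i j = max (\<alpha> i j) (\<delta> i (j - 1))"
    and departure: "1 \<le> j \<Longrightarrow> \<delta> i j = \<beta> i j + ereal (\<tau> i j)"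
    and departure_0: "\<delta> i 0 = 0"

text \<open>
  If service times may vanish, the equations alone also admit unphysical solutions, in which a
  customer that was never in the network circulates in zero time and is its own cause (for
  instance one node, \<open>n = 0\<close>, \<open>\<tau> = 0\<close>, all times equal to 1). In the network, simultaneous
  events still happen one after another: there is a well-founded precedence between services
  such that a service is preceded by the previous one at its node, and such that the \<open>j\<close>th
  arrival at a node is accounted for by initial customers and by preceding departures.
  For positive service times this is automatic, see \<open>positive_imp_network\<close> below.
\<close>

locale queueing_network = queueing_equations +
  assumes causal: "\<exists>R. wf R \<and> (\<forall>i j. 1 \<le> j \<and> \<beta> i j \<noteq> \<infinity> \<longrightarrow>
      (2 \<le> j \<longrightarrow> ((i, j - 1), (i, j)) \<in> R) \<and>
      enat j \<le> n i + ecard {(k, m) \<in> routed S i. \<delta> k m \<le> \<alpha> i j \<and> ((k, m), (i, j)) \<in> R})"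

text \<open>
  Functions of the service times composed by \<open>max\<close>, \<open>min\<close> and \<open>+\<close>. The constant 0 is the
  initial time; it cannot be dispensed with, as \<open>\<alpha> i 1 = \<beta> i 1 = 0\<close> if \<open>n i > 0\<close>.
\<close>

inductive_set max_min_plus :: "(('l \<Rightarrow> nat \<Rightarrow> real) \<Rightarrow> real) set" where
  zero: "(\<lambda>T. 0) \<in> max_min_plus"
| service: "1 \<le> j \<Longrightarrow> (\<lambda>T. T i j) \<in> max_min_plus"
| max: "f \<in> max_min_plus \<Longrightarrow> g \<in> max_min_plus \<Longrightarrow> (\<lambda>T. max (f T) (g T)) \<in> max_min_plus"
| min: "f \<in> max_min_plus \<Longrightarrow> g \<in> max_min_plus \<Longrightarrow> (\<lambda>T. min (f T) (g T)) \<in> max_min_plus"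
| plus: "f \<in> max_min_plus \<Longrightarrow> g \<in> max_min_plus \<Longrightarrow> (\<lambda>T. f T + g T) \<in> max_min_plus"

context queueing_equations
begin

lemma arrival_nonneg: "1 \<le> j \<Longrightarrow> 0 \<le> \<alpha> i j"
  by (auto simp: arrival intro!: Inf_greatest)

lemma departure_step: "\<delta> i j \<le> \<delta> i (Suc j)"
proof -
  have "\<delta> i j \<le> \<beta> i (Suc j)" using initiation[of "Suc j" i] by simp
  also have "\<dots> \<le> \<beta> i (Suc j) + ereal (\<tau> i (Suc j))"
    using service_nonneg[of "Suc j" i] by (simp add: add_increasing2)
  finally show ?thesis using departure[of "Suc j" i] by simp
qed

lemma departure_mono: "j \<le> k \<Longrightarrow> \<delta> i j \<le> \<delta> i k"
  by (rule lift_Suc_mono_le[of "\<delta> i"]) (auto intro: departure_step)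

lemma departure_nonneg: "0 \<le> \<delta> i j"
  using departure_mono[of 0 j i] departure_0 by simp

lemma arrival_attained:
  assumes j: "1 \<le> j" and fin: "\<alpha> i j \<noteq> \<infinity>"
  shows "enat j \<le> n i + ecard {(k, m) \<in> routed S i. \<delta> k m \<le> \<alpha> i j}"
proof -
  obtain a where a: "\<alpha> i j = ereal a" "0 \<le> a"
    using fin arrival_nonneg[OF j, of i] by (cases "\<alpha> i j") auto
  define late where "late k = {m. 1 \<le> m \<and> S k m = i \<and> ereal a < \<delta> k m}" for k
  define b where "b = Min (insert \<infinity> ((\<lambda>k. \<delta> k (LEAST m. m \<in> late k)) ` {k. late k \<noteq> {}}))"
  have least: "(LEAST m. m \<in> late k) \<in> late k" if "late k \<noteq> {}" for k
    using that by (meson LeastI ex_in_conv)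
  have ab: "ereal a < b"
    unfolding b_def using least by (subst Min_gr_iff) (auto simp: late_def)
  have late_ge: "b \<le> \<delta> k m" if "m \<in> late k" for k m
  proof -
    have "b \<le> \<delta> k (LEAST m. m \<in> late k)"
      unfolding b_def using that by (intro Min_le) auto
    also have "\<dots> \<le> \<delta> k m" using that by (intro departure_mono Least_le)
    finally show ?thesis .
  qed
  obtain c where c: "ereal a < ereal c" "ereal c < b"
    using ab ereal_dense2 by blast
  have "\<alpha> i j < ereal c" using a c by simp
  then obtain t where t: "0 \<le> t" "enat j \<le> arrivals n S \<delta> i t" "ereal t < ereal c"
    unfolding arrival[OF j] Inf_less_iff by blast
  have "ereal a \<le> ereal t"
    unfolding a(1)[symmetric] arrival[OF j] using t by (intro Inf_lower) auto
  moreover have "\<delta> k m \<le> ereal a" if "(k, m) \<in> routed S i" "\<delta> k m \<le> ereal t" for k m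
  proof (rule ccontr)
    assume "\<not> \<delta> k m \<le> ereal a"
    then have "m \<in> late k" using that by (auto simp: late_def routed_def)
    then show False using late_ge that t(3) c(2) by (meson leD le_less_trans less_trans)
  qed
  ultimately have "{(k, m) \<in> routed S i. \<delta> k m \<le> ereal t} = {(k, m) \<in> routed S i. \<delta> k m \<le> \<alpha> i j}"
    unfolding a(1) by (auto intro: order_trans)
  then show ?thesis using t(2) by (simp add: arrivals_def)
qed

lemma positive_imp_network:
  assumes pos: "\<And>i j. 1 \<le> j \<Longrightarrow> 0 < \<tau> i j"
  shows "queueing_network n S \<tau> \<alpha> \<beta> \<delta>"
proof
  define R where "R = {((k, m), (i, j)). \<delta> k m < \<delta> i j}"
  have "wf R"
  proof (rule ccontr)
    assume "\<not> wf R"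
    then obtain f where f: "\<And>p. (f (Suc p), f p) \<in> R"
      unfolding wf_iff_no_infinite_down_chain by blast
    define d where "d p = \<delta> (fst (f p)) (snd (f p))" for p
    have "d (Suc p) < d p" for p using f[of p] by (auto simp: R_def d_def split: prod.splits)
    then have dec: "d q < d p" if "p < q" for p q
      using lift_Suc_mono_less[of "\<lambda>p. - d p" p q] that by simp
    obtain k where "infinite {p. fst (f p) = k}"
    proof -
      have "\<exists>k\<in>UNIV. infinite {p \<in> UNIV. fst (f p) = k}"
        by (rule pigeonhole_infinite_rel) auto
      then show ?thesis using that by auto
    qed
    then obtain g :: "nat \<Rightarrow> nat" where g: "strict_mono g" "\<And>q. fst (f (g q)) = k"
      using infinite_enumerate by blast
    have "snd (f (g (Suc q))) < snd (f (g q))" for q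
    proof (rule ccontr)
      assume "\<not> ?thesis"
      then have "d (g q) \<le> d (g (Suc q))" unfolding d_def g by (intro departure_mono) simp
      moreover have "d (g (Suc q)) < d (g q)" using g(1) by (intro dec) (simp add: strict_mono_Suc_iff)
      ultimately show False by simp
    qed
    then have "\<exists>s. \<forall>q. (s (Suc q), s q) \<in> less_than"
      by (intro exI[of _ "\<lambda>q. snd (f (g q))"]) simp
    then show False using wf_less_than unfolding wf_iff_no_infinite_down_chain by blast
  qed
  moreover have "(2 \<le> j \<longrightarrow> ((i, j - 1), (i, j)) \<in> R) \<and>
      enat j \<le> n i + ecard {(k, m) \<in> routed S i. \<delta> k m \<le> \<alpha> i j \<and> ((k, m), (i, j)) \<in> R}"
    if "1 \<le> j \<and> \<beta> i j \<noteq> \<infinity>" for i j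
  proof -
    have \<beta>: "\<beta> i j = max (\<alpha> i j) (\<delta> i (j - 1))" using that initiation by simp
    have "0 \<le> \<beta> i j" unfolding \<beta> using departure_nonneg by (simp add: le_max_iff_disj)
    then have less: "\<beta> i j < \<delta> i j"
      using that pos[of j i] departure[of j i] by (cases "\<beta> i j") auto
    have "\<alpha> i j \<noteq> \<infinity>" using that \<beta> by auto
    moreover have "((k, m), (i, j)) \<in> R" if "\<delta> k m \<le> \<alpha> i j" for k m
      using that less \<beta> by (auto simp: R_def)
    then have "{(k, m) \<in> routed S i. \<delta> k m \<le> \<alpha> i j \<and> ((k, m), (i, j)) \<in> R}
        = {(k, m) \<in> routed S i. \<delta> k m \<le> \<alpha> i j}" by auto
    moreover have "((i, j - 1), (i, j)) \<in> R" using less \<beta> by (auto simp: R_def)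
    ultimately show ?thesis using arrival_attained that by simp
  qed
  ultimately show "\<exists>R. wf R \<and> (\<forall>i j. 1 \<le> j \<and> \<beta> i j \<noteq> \<infinity> \<longrightarrow>
      (2 \<le> j \<longrightarrow> ((i, j - 1), (i, j)) \<in> R) \<and>
      enat j \<le> n i + ecard {(k, m) \<in> routed S i. \<delta> k m \<le> \<alpha> i j \<and> ((k, m), (i, j)) \<in> R})"
    by blast
qed

end

end

theory Submission
  imports Defs
begin

text \<open>
  An arrival time at node \<open>i\<close> is an order statistic of the departure times routed to \<open>i\<close>, and
  since departures from each node are ordered, only finitely many of them compete. Unfolding this
  recursion need not terminate, as it can return to a node with a larger index. But a service whose
  cause contains a later service at the same node would precede itself, so terms in which the index
  at a node does not decrease along the unfolding may be replaced by \<open>\<infinity>\<close>: this keeps the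
  expression an upper bound, and leaves the set realizing the minimum untouched. Decreasing indices
  at finitely many nodes make the truncated recursion terminate, uniformly in the service times.
\<close>

section \<open>Max-min-plus expressions with infinity adjoined\<close>

text \<open>Infinity is taken everywhere or nowhere, so a member finite at a single argument is a
  genuine max-min-plus function. The class stays closed because infinity absorbs under
  \<open>max\<close> and \<open>+\<close> and is neutral for \<open>min\<close>.\<close>

definition emax_min_plus :: "(('l \<Rightarrow> nat \<Rightarrow> real) \<Rightarrow> ereal) set" where
  "emax_min_plus = insert (\<lambda>T. \<infinity>) ((\<lambda>f T. ereal (f T)) ` max_min_plus)"

lemma emax_min_plus_infinity: "(\<lambda>T. \<infinity>) \<in> emax_min_plus"
  by (simp add: emax_min_plus_def)

lemma emax_min_plus_ereal: "f \<in> max_min_plus \<Longrightarrow> (\<lambda>T. ereal (f T)) \<in> emax_min_plus"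
  by (auto simp: emax_min_plus_def)

lemma emax_min_plus_zero: "(\<lambda>T. 0) \<in> emax_min_plus"
  using emax_min_plus_ereal[OF max_min_plus.zero] by (simp add: zero_ereal_def)

lemma emax_min_plus_service: "1 \<le> j \<Longrightarrow> (\<lambda>T. ereal (T i j)) \<in> emax_min_plus"
  by (intro emax_min_plus_ereal max_min_plus.service)

lemma emax_min_plus_cases:
  assumes "F \<in> emax_min_plus"
  obtains "F = (\<lambda>T. \<infinity>)" | f where "f \<in> max_min_plus" "F = (\<lambda>T. ereal (f T))"
  using assms by (auto simp: emax_min_plus_def)

lemma emax_min_plus_max:
  assumes "F \<in> emax_min_plus" "G \<in> emax_min_plus"
  shows "(\<lambda>T. max (F T) (G T)) \<in> emax_min_plus"
  using assms(1)
proof (cases rule: emax_min_plus_cases)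
  case 1
  then show ?thesis by (simp add: emax_min_plus_infinity)
next
  case f: (2 f)
  show ?thesis using assms(2)
  proof (cases rule: emax_min_plus_cases)
    case 1
    then show ?thesis by (simp add: emax_min_plus_infinity)
  next
    case (2 g)
    with f show ?thesis using emax_min_plus_ereal[OF max_min_plus.max[of f g]] by simp
  qed
qed

lemma emax_min_plus_min:
  assumes "F \<in> emax_min_plus" "G \<in> emax_min_plus"
  shows "(\<lambda>T. min (F T) (G T)) \<in> emax_min_plus"
  using assms(1)
proof (cases rule: emax_min_plus_cases)
  case 1
  then show ?thesis using assms(2) by (simp add: min_def)
next
  case f: (2 f)
  show ?thesis using assms(2)
  proof (cases rule: emax_min_plus_cases)
    case 1
    then show ?thesis using assms(1) by (simp add: min_def)
  next
    case (2 g)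
    with f show ?thesis using emax_min_plus_ereal[OF max_min_plus.min[of f g]] by simp
  qed
qed

lemma emax_min_plus_plus:
  assumes "F \<in> emax_min_plus" "G \<in> emax_min_plus"
  shows "(\<lambda>T. F T + G T) \<in> emax_min_plus"
  using assms(1)
proof (cases rule: emax_min_plus_cases)
  case 1
  then show ?thesis by (simp add: emax_min_plus_infinity)
next
  case f: (2 f)
  show ?thesis using assms(2)
  proof (cases rule: emax_min_plus_cases)
    case 1
    then show ?thesis by (simp add: emax_min_plus_infinity)
  next
    case (2 g)
    with f show ?thesis using emax_min_plus_ereal[OF max_min_plus.plus[of f g]] by simp
  qed
qed

lemma emax_min_plus_INF:
  assumes "finite I" "\<And>x. x \<in> I \<Longrightarrow> F x \<in> emax_min_plus"
  shows "(\<lambda>T. INF x\<in>I. F x T) \<in> emax_min_plus"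
  using assms
proof (induction I rule: finite_induct)
  case empty
  then show ?case using emax_min_plus_infinity by (simp add: top_ereal_def)
next
  case (insert x I)
  then show ?case using emax_min_plus_min[of "F x" "\<lambda>T. INF x\<in>I. F x T"] by (simp add: inf_min)
qed

text \<open>The outer \<open>max 0\<close> repairs the empty supremum, which is minus infinity and
  lies outside the class.\<close>

lemma emax_min_plus_SUP:
  assumes "finite I" "\<And>x. x \<in> I \<Longrightarrow> F x \<in> emax_min_plus"
  shows "(\<lambda>T. max 0 (SUP x\<in>I. F x T)) \<in> emax_min_plus"
  using assms
proof (induction I rule: finite_induct)
  case empty
  then show ?case using emax_min_plus_zero by (simp add: bot_ereal_def max_def)
next
  case (insert x I)
  then show ?case
    using emax_min_plus_max[of "F x" "\<lambda>T. max 0 (SUP x\<in>I. F x T)"]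
    by (simp add: sup_max max.left_commute)
qed

text \<open>If \<open>F\<close> is identically infinite, the zero function serves as a dummy
  witness.\<close>

lemma emax_min_plus_represents:
  assumes "F \<in> emax_min_plus"
  shows "\<exists>f\<in>max_min_plus. \<forall>T. F T \<noteq> \<infinity> \<longrightarrow> F T = ereal (f T)"
  using assms by (cases rule: emax_min_plus_cases) (use max_min_plus.zero in auto)

section \<open>Bounding arrival times by sets of departures\<close>

lemma ecard_mono: "A \<subseteq> B \<Longrightarrow> ecard A \<le> ecard B"
  by (auto simp: ecard_def intro: card_mono finite_subset)

text \<open>By the time on the right, every departure in \<open>A\<close> has reached node
  \<open>i\<close>, so at least \<open>j\<close> arrivals have been counted. No causality is
  involved, so the bound holds for every candidate set \<open>A\<close>.\<close>

lemma (in queueing_equations) arrival_le_Sup_departures: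
  assumes j: "1 \<le> j" and A: "A \<subseteq> routed S i" "enat j \<le> n i + ecard A"
  shows "\<alpha> i j \<le> max 0 (SUP (k, m)\<in>A. \<delta> k m)"
proof -
  define s where "s = max 0 (SUP (k, m)\<in>A. \<delta> k m)"
  have le: "\<delta> k m \<le> s" if "(k, m) \<in> A" for k m
    unfolding s_def using that by (auto simp: le_max_iff_disj intro: SUP_upper2)
  have "\<alpha> i j \<le> s"
  proof (cases s)
    case (real t)
    have "0 \<le> s" by (simp add: s_def)
    then have "0 \<le> t" using real by simp
    have "A \<subseteq> {(k, m) \<in> routed S i. \<delta> k m \<le> ereal t}" using le A(1) real by auto
    then have "enat j \<le> arrivals n S \<delta> i t"
      unfolding arrivals_def by (meson A(2) add_left_mono ecard_mono order_trans)
    then show ?thesis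
      unfolding arrival[OF j] real using \<open>0 \<le> t\<close> by (intro Inf_lower) auto
  \<comment> \<open>The value plus infinity makes the bound trivial, and minus infinity is excluded
    by the \<open>max\<close> with 0.\<close>
  qed (auto simp: s_def max_def split: if_splits)
  then show ?thesis by (simp add: s_def)
qed

section \<open>Transitive precedence between services\<close>

text \<open>Transitivity lets causes be compared along whole chains. Finiteness at the source says
  that a cause has itself occurred, so \<open>step_R\<close> and \<open>causal_R\<close> apply to it
  in turn.\<close>

locale causal_network = queueing_equations +
  fixes R :: "(('a::finite \<times> nat) \<times> 'a \<times> nat) set"
  assumes wf_R: "wf R" and trans_R: "trans R"
    and finite_R: "((k, m), q) \<in> R \<Longrightarrow> \<delta> k m \<noteq> \<infinity>"
    and step_R: "2 \<le> j \<Longrightarrow> \<beta> i j \<noteq> \<infinity> \<Longrightarrow> ((i, j - 1), (i, j)) \<in> R"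
    and causal_R: "1 \<le> j \<Longrightarrow> \<beta> i j \<noteq> \<infinity> \<Longrightarrow>
      enat j \<le> n i + ecard {(k, m) \<in> routed S i. \<delta> k m \<le> \<alpha> i j \<and> ((k, m), (i, j)) \<in> R}"

lemma (in queueing_equations) initiation_finite_iff:
  "1 \<le> j \<Longrightarrow> \<beta> i j = \<infinity> \<longleftrightarrow> \<delta> i j = \<infinity>"
  by (simp add: departure)

text \<open>Discard pairs whose source never departs, then close transitively. The required pairs
  survive: if \<beta> is finite, so are the previous departure at the node and every departure not
  later than \<alpha>.\<close>

lemma (in queueing_network) ex_causal_network: "\<exists>R. causal_network n S \<tau> \<alpha> \<beta> \<delta> R"
proof -
  obtain R where R: "wf R"
    "\<And>i j. 1 \<le> j \<Longrightarrow> \<beta> i j \<noteq> \<infinity> \<Longrightarrow> 2 \<le> j \<Longrightarrow> ((i, j - 1), (i, j)) \<in> R"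
    "\<And>i j. 1 \<le> j \<Longrightarrow> \<beta> i j \<noteq> \<infinity> \<Longrightarrow>
      enat j \<le> n i + ecard {(k, m) \<in> routed S i. \<delta> k m \<le> \<alpha> i j \<and> ((k, m), (i, j)) \<in> R}"
    using causal by blast
  define Q where "Q = {((k, m), q) \<in> R. \<delta> k m \<noteq> \<infinity>}"
  have "causal_network n S \<tau> \<alpha> \<beta> \<delta> (Q\<^sup>+)"
  proof
    have "Q \<subseteq> R" by (auto simp: Q_def)
    then show "wf (Q\<^sup>+)" using R(1) by (meson wf_subset wf_trancl)
    show "trans (Q\<^sup>+)" by simp
    show "\<delta> k m \<noteq> \<infinity>" if "((k, m), q) \<in> Q\<^sup>+" for k m q
      using tranclD[OF that] by (auto simp: Q_def)
    show "((i, j - 1), (i, j)) \<in> Q\<^sup>+" if "2 \<le> j" "\<beta> i j \<noteq> \<infinity>" for i j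
    proof -
      have "\<delta> i (j - 1) \<noteq> \<infinity>" using that initiation[of j i] by auto
      then show ?thesis using that R(2)[of j i] by (intro r_into_trancl) (simp add: Q_def)
    qed
    show "enat j \<le> n i + ecard {(k, m) \<in> routed S i. \<delta> k m \<le> \<alpha> i j \<and> ((k, m), (i, j)) \<in> Q\<^sup>+}"
      if j: "1 \<le> j" "\<beta> i j \<noteq> \<infinity>" for i j
    proof -
      have "\<alpha> i j \<noteq> \<infinity>" using j initiation[of j i] by auto
      then have "{(k, m) \<in> routed S i. \<delta> k m \<le> \<alpha> i j \<and> ((k, m), (i, j)) \<in> R}
          \<subseteq> {(k, m) \<in> routed S i. \<delta> k m \<le> \<alpha> i j \<and> ((k, m), (i, j)) \<in> Q\<^sup>+}"
        by (auto simp: Q_def intro!: r_into_trancl)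
      then show ?thesis using R(3)[OF j] by (meson add_left_mono ecard_mono order_trans)
    qed
  qed
  then show ?thesis ..
qed

context causal_network
begin

lemma earlier_service_R:
  assumes "1 \<le> j" "j < m" "\<delta> i m \<noteq> \<infinity>"
  shows "((i, j), (i, m)) \<in> R"
  using assms(2,3)
proof (induction m rule: less_induct)
  case (less m)
  have m: "2 \<le> m" "1 \<le> m" using less.prems assms(1) by auto
  then have step: "((i, m - 1), (i, m)) \<in> R"
    using less.prems(2) step_R initiation_finite_iff by blast
  show ?case
  proof (cases "j = m - 1")
    case False
    then have "((i, j), (i, m - 1)) \<in> R"
      using less.prems m finite_R[OF step] by (intro less.IH) auto
    then show ?thesis using step trans_R by (meson transD)
  qed (use step in simp)
qed

text \<open>Otherwise the services at node \<open>i\<close> from \<open>j\<close> up to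
  \<open>m\<close> form a chain that closes to a cycle at \<open>(i, j)\<close>, against
  well-foundedness. This is what permits truncation: unfolding never has to return to a node with an
  index that is not smaller.\<close>

lemma predecessor_index_less:
  assumes "1 \<le> j" "((i, m), (i, j)) \<in> R"
  shows "m < j"
proof (rule ccontr)
  assume "\<not> m < j"
  then consider "m = j" | "j < m" by linarith
  then have "((i, j), (i, j)) \<in> R"
  proof cases
    case 2
    then have "((i, j), (i, m)) \<in> R"
      using earlier_service_R assms finite_R by blast
    then show ?thesis using assms trans_R by (meson transD)
  qed (use assms in simp)
  then show False using wf_R by (meson wf_not_refl)
qed

text \<open>If a cause from node \<open>k\<close> has index above \<open>N\<close>, then all
  departures from \<open>k\<close> to \<open>i\<close> with index up to \<open>N\<close> are earlier
  causes as well, and by the choice of \<open>N\<close> there are already \<open>j\<close> of them.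
  So finitely many candidates suffice.\<close>

lemma causal_R_truncated:
  assumes j: "1 \<le> j" "\<beta> i j \<noteq> \<infinity>"
    and N: "\<And>k. (\<forall>m. (k, m) \<in> routed S i \<longrightarrow> m \<le> N) \<or> j \<le> card {m. (k, m) \<in> routed S i \<and> m \<le> N}"
  shows "enat j \<le> n i + ecard {(k, m) \<in> routed S i. m \<le> N \<and> \<delta> k m \<le> \<alpha> i j \<and> ((k, m), (i, j)) \<in> R}"
    (is "_ \<le> _ + ecard ?B")
proof (cases "\<forall>k m. (k, m) \<in> routed S i \<and> \<delta> k m \<le> \<alpha> i j \<and> ((k, m), (i, j)) \<in> R \<longrightarrow> m \<le> N")
  case True
  then have "{(k, m) \<in> routed S i. \<delta> k m \<le> \<alpha> i j \<and> ((k, m), (i, j)) \<in> R} = ?B" by auto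
  then show ?thesis using causal_R[OF j] by simp
next
  case False
  then obtain k m where km: "(k, m) \<in> routed S i" "\<delta> k m \<le> \<alpha> i j" "((k, m), (i, j)) \<in> R" "N < m"
    by (auto simp: not_le)
  then have card: "j \<le> card {m. (k, m) \<in> routed S i \<and> m \<le> N}" (is "_ \<le> card ?M")
    using N[of k] by fastforce
  have "Pair k ` ?M \<subseteq> ?B"
  proof
    fix p assume "p \<in> Pair k ` ?M"
    then obtain l where p: "p = (k, l)" and l: "(k, l) \<in> routed S i" "l \<le> N" by blast
    have "\<delta> k l \<le> \<alpha> i j" using departure_mono[of l m k] l km by (auto intro: order_trans)
    moreover have "((k, l), (k, m)) \<in> R"
      using l km finite_R by (intro earlier_service_R) (auto simp: routed_def)
    then have "((k, l), (i, j)) \<in> R" using km trans_R by (meson transD)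
    ultimately show "p \<in> ?B" using l by (simp add: p)
  qed
  then have sub: "ecard (Pair k ` ?M) \<le> ecard ?B" by (rule ecard_mono)
  have "enat j \<le> enat (card ?M)" using card by simp
  also have "\<dots> = ecard (Pair k ` ?M)" by (simp add: ecard_def card_image inj_on_def)
  also note sub
  also have "ecard ?B \<le> n i + ecard ?B" by simp
  finally show ?thesis .
qed

end

section \<open>Termination of the unfolding\<close>

text \<open>The reflexive closure makes the bound apply to the service \<open>q\<close> itself too.
  The bound \<infinity> imposes no restriction at that node.\<close>

definition bounded_past :: "(('l \<times> nat) \<times> 'l \<times> nat) set \<Rightarrow> ('l \<Rightarrow> enat) \<Rightarrow> 'l \<times> nat \<Rightarrow> bool" where
  "bounded_past R b q \<longleftrightarrow> (\<forall>k m. ((k, m), q) \<in> R\<^sup>= \<longrightarrow> enat m < b k)"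

text \<open>By transitivity, the past of \<open>p\<close> together with \<open>p\<close> lies in the
  past of \<open>(i, j)\<close>, where indices at node \<open>i\<close> are below \<open>j\<close>
  by \<open>predecessor_index_less\<close>.\<close>

lemma (in causal_network) bounded_past_update:
  assumes b: "bounded_past R b (i, j)" and j: "1 \<le> j" and p: "(p, (i, j)) \<in> R"
  shows "bounded_past R (b(i := enat j)) p"
  unfolding bounded_past_def
proof (intro allI impI)
  fix k m assume "((k, m), p) \<in> R\<^sup>="
  then have "((k, m), (i, j)) \<in> R" using p trans_R by (auto dest: transD)
  then show "enat m < (b(i := enat j)) k"
    using b j predecessor_index_less by (auto simp: bounded_past_def)
qed

text \<open>A node sending finitely many customers to \<open>i\<close> is bounded by its last such
  index, any other node by an index that covers \<open>j\<close> of them. The maximum over the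
  finitely many nodes keeps both properties, and it does not involve the service times.\<close>

lemma ex_routed_bound:
  fixes S :: "'l::finite \<Rightarrow> nat \<Rightarrow> 'l"
  obtains N where
    "\<And>k. (\<forall>m. (k, m) \<in> routed S i \<longrightarrow> m \<le> N) \<or> j \<le> card {m. (k, m) \<in> routed S i \<and> m \<le> N}"
proof -
  let ?M = "\<lambda>k. {m. (k, m) \<in> routed S i}"
  have "\<exists>N. ?M k \<subseteq> {..N} \<or> j \<le> card (?M k \<inter> {..N})" for k
  proof (cases "finite (?M k)")
    case True
    then show ?thesis by (meson finite_nat_iff_bounded_le)
  next
    case False
    then obtain X where X: "X \<subseteq> ?M k" "finite X" "card X = j"
      by (meson infinite_arbitrarily_large)
    then obtain N where "X \<subseteq> {..N}" by (meson finite_nat_iff_bounded_le)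
    then have "card X \<le> card (?M k \<inter> {..N})" using X by (intro card_mono) auto
    then show ?thesis using X by blast
  qed
  then obtain N where N: "\<And>k. ?M k \<subseteq> {..N k} \<or> j \<le> card (?M k \<inter> {..N k})" by metis
  have "(\<forall>m. (k, m) \<in> routed S i \<longrightarrow> m \<le> Max (range N)) \<or>
      j \<le> card {m. (k, m) \<in> routed S i \<and> m \<le> Max (range N)}" for k
  proof -
    have le: "m \<le> Max (range N)" if "m \<le> N k" for m
      using that by (meson Max_ge finite finite_imageI order_trans rangeI)
    have "card (?M k \<inter> {..N k}) \<le> card {m. (k, m) \<in> routed S i \<and> m \<le> Max (range N)}"
      using le by (intro card_mono) auto
    then show ?thesis using N[of k] le by (meson atMost_iff mem_Collect_eq order_trans subsetD)
  qed
  then show ?thesis by (rule that)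
qed

text \<open>The lexicographic measure is the number of infinite bounds, then the sum of the finite
  ones. Replacing an infinite bound may enlarge the sum but lowers the count.\<close>

lemma wf_update_less: "wf {(b(i := enat j), b) | (b :: 'l::finite \<Rightarrow> enat) i j. enat j < b i}"
proof -
  define u where "u b = card {k. b k = \<infinity>}" for b :: "'l \<Rightarrow> enat"
  define v where "v b = (\<Sum>k | b k \<noteq> \<infinity>. the_enat (b k))" for b :: "'l \<Rightarrow> enat"
  have "(b(i := enat j), b) \<in> inv_image (less_than <*lex*> less_than) (\<lambda>b. (u b, v b))"
    if "enat j < b i" for b :: "'l \<Rightarrow> enat" and i j
  proof (cases "b i")
    case (enat l)
    have eq: "{k. (b(i := enat j)) k = \<infinity>} = {k. b k = \<infinity>}"
      "{k. (b(i := enat j)) k \<noteq> \<infinity>} = {k. b k \<noteq> \<infinity>}"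
      using enat by auto
    have "v (b(i := enat j)) < v b"
      unfolding v_def eq using enat that by (intro sum_strict_mono_ex1) auto
    moreover have "u (b(i := enat j)) = u b" unfolding u_def eq ..
    ultimately show ?thesis by simp
  next
    case infinity
    have "u (b(i := enat j)) < u b"
      unfolding u_def using infinity by (intro psubset_card_mono) (auto split: if_splits)
    then show ?thesis by simp
  qed
  then have "{(b(i := enat j), b) | (b :: 'l \<Rightarrow> enat) i j. enat j < b i}
      \<subseteq> inv_image (less_than <*lex*> less_than) (\<lambda>b. (u b, v b))" by blast
  then show ?thesis by (rule wf_subset[rotated]) (intro wf_inv_image wf_lex_prod wf_less_than)
qed

section \<open>The truncated recursion\<close>

text \<open>The expressions are chosen before the service times and \<open>R\<close>, hence
  uniformly. The unconditional bound on \<delta> is needed in the induction: terms outside the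
  causal past may be inexact, but must not pull a minimum below the true value.\<close>

lemma truncated_representation:
  fixes n :: "'l::finite \<Rightarrow> enat" and S :: "'l \<Rightarrow> nat \<Rightarrow> 'l" and b :: "'l \<Rightarrow> enat"
  assumes "1 \<le> j"
  shows "\<exists>F\<in>emax_min_plus. \<exists>G\<in>emax_min_plus. \<exists>H\<in>emax_min_plus.
    \<forall>\<tau> \<alpha> \<beta> \<delta> R. causal_network n S \<tau> \<alpha> \<beta> \<delta> R \<longrightarrow>
      \<delta> i j \<le> H \<tau> \<and>
      (bounded_past R b (i, j) \<and> \<beta> i j \<noteq> \<infinity> \<longrightarrow> \<alpha> i j = F \<tau> \<and> \<beta> i j = G \<tau> \<and> \<delta> i j = H \<tau>)"
  using assms
proof (induction b arbitrary: i j rule: wf_induct_rule[OF wf_update_less])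
  case (1 b i j)
  note j = \<open>1 \<le> j\<close>
  show ?case
  proof (cases "enat j < b i")
    case False
    then have "\<not> bounded_past R b (i, j)" for R by (auto simp: bounded_past_def)
    \<comment> \<open>Here the truncation takes place: the constant \<infinity> is an upper bound,
      and exactness is vacuous.\<close>
    then show ?thesis by (intro bexI[OF _ emax_min_plus_infinity]) simp
  next
    case True
    define b' where "b' = b(i := enat j)"
    \<comment> \<open>Only departure expressions of other services enter the recursion, so this part
      of the induction hypothesis is enough.\<close>
    define Q where "Q k m H \<longleftrightarrow> H \<in> emax_min_plus \<and>
      (\<forall>\<tau> \<alpha> \<beta> \<delta> R. causal_network n S \<tau> \<alpha> \<beta> \<delta> R \<longrightarrow>
        \<delta> k m \<le> H \<tau> \<and> (bounded_past R b' (k, m) \<and> \<beta> k m \<noteq> \<infinity> \<longrightarrow> \<delta> k m = H \<tau>))" for k m H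
    have ex: "\<exists>H. Q k m H" if "1 \<le> m" for k m
    proof -
      have "(b', b) \<in> {(b(i := enat j), b) | b i j. enat j < b i}"
        using True by (auto simp: b'_def)
      from "1.IH"[OF this that, of k] show ?thesis unfolding Q_def by blast
    qed
    define D where "D k m = (SOME H. Q k m H)" for k m
    have QD: "Q k m (D k m)" if "1 \<le> m" for k m
      unfolding D_def using ex[OF that] by (rule someI_ex)
    have D: "D k m \<in> emax_min_plus"
      "causal_network n S \<tau> \<alpha> \<beta> \<delta> R \<Longrightarrow> \<delta> k m \<le> D k m \<tau>"
      "causal_network n S \<tau> \<alpha> \<beta> \<delta> R \<Longrightarrow> bounded_past R b' (k, m) \<Longrightarrow>
        \<beta> k m \<noteq> \<infinity> \<Longrightarrow> \<delta> k m = D k m \<tau>"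
      if "1 \<le> m" for k m \<tau> \<alpha> \<beta> \<delta> R
      using QD[OF that, of k] unfolding Q_def by blast+
    obtain N where N:
      "\<And>k. (\<forall>m. (k, m) \<in> routed S i \<longrightarrow> m \<le> N) \<or> j \<le> card {m. (k, m) \<in> routed S i \<and> m \<le> N}"
      using ex_routed_bound[of S i j] by blast
    define C where "C = {(k, m) \<in> routed S i. m \<le> N}"
    have "finite C" by (rule finite_subset[of _ "UNIV \<times> {..N}"]) (auto simp: C_def)
    define AA where "AA = {A. A \<subseteq> C \<and> enat j \<le> n i + ecard A}"
    have "finite AA" using \<open>finite C\<close> by (simp add: AA_def)
    \<comment> \<open>The order statistic as a minimum over candidate sets of the time when the
      whole set has departed. The 0 gives the value for the empty set, a candidate when initial
      customers suffice.\<close>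
    define F where "F T = (INF A\<in>AA. max 0 (SUP (k, m)\<in>A. D k m T))" for T
    \<comment> \<open>Index 0 is separated because \<open>D\<close> is specified only for indices
      from 1 on.\<close>
    define P where "P = (if j = 1 then (\<lambda>T. 0) else D i (j - 1))"
    have "F \<in> emax_min_plus"
    proof -
      have "(\<lambda>T. max 0 (SUP p\<in>A. D (fst p) (snd p) T)) \<in> emax_min_plus" if "A \<in> AA" for A
        using that \<open>finite C\<close> D(1)
        by (intro emax_min_plus_SUP) (auto simp: AA_def C_def routed_def intro: finite_subset)
      from emax_min_plus_INF[OF \<open>finite AA\<close> this] show ?thesis
        by (simp add: F_def[abs_def] case_prod_unfold)
    qed
    have "P \<in> emax_min_plus" using j D(1)[of "j - 1" i] by (simp add: P_def emax_min_plus_zero)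
    define G where "G T = max (F T) (P T)" for T
    have "G \<in> emax_min_plus"
      unfolding G_def[abs_def] by (intro emax_min_plus_max) fact+
    define H where "H T = G T + ereal (T i j)" for T
    have "H \<in> emax_min_plus"
      unfolding H_def[abs_def] by (intro emax_min_plus_plus emax_min_plus_service j) fact
    have "\<delta> i j \<le> H \<tau> \<and>
      (bounded_past R b (i, j) \<and> \<beta> i j \<noteq> \<infinity> \<longrightarrow> \<alpha> i j = F \<tau> \<and> \<beta> i j = G \<tau> \<and> \<delta> i j = H \<tau>)"
      if net: "causal_network n S \<tau> \<alpha> \<beta> \<delta> R" for \<tau> \<alpha> \<beta> \<delta> R
    proof -
      interpret causal_network n S \<tau> \<alpha> \<beta> \<delta> R by (rule net)
      have "\<alpha> i j \<le> F \<tau>"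
        unfolding F_def
      proof (rule INF_greatest)
        fix A assume "A \<in> AA"
        then have A: "A \<subseteq> routed S i" "enat j \<le> n i + ecard A" by (auto simp: AA_def C_def)
        have "\<alpha> i j \<le> max 0 (SUP (k, m)\<in>A. \<delta> k m)"
          by (rule arrival_le_Sup_departures[OF j A])
        also have "\<dots> \<le> max 0 (SUP (k, m)\<in>A. D k m \<tau>)"
          using A(1) D(2)[OF _ net]
          by (intro max.mono order_refl SUP_subset_mono) (auto simp: routed_def)
        finally show "\<alpha> i j \<le> max 0 (SUP (k, m)\<in>A. D k m \<tau>)" .
      qed
      moreover have "\<delta> i (j - 1) \<le> P \<tau>"
        using j D(2)[OF _ net, of "j - 1" i] by (auto simp: P_def departure_0)
      ultimately have "\<beta> i j \<le> G \<tau>"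
        unfolding initiation[OF j] G_def by (rule max.mono)
      then have "\<delta> i j \<le> H \<tau>" unfolding departure[OF j] H_def by (rule add_right_mono)
      moreover have "\<alpha> i j = F \<tau> \<and> \<beta> i j = G \<tau> \<and> \<delta> i j = H \<tau>"
        if past: "bounded_past R b (i, j)" and fin: "\<beta> i j \<noteq> \<infinity>"
      proof -
        \<comment> \<open>Causes of \<open>(i, j)\<close> have their past bounded by
          \<open>b'\<close> and have occurred, so the induction hypothesis is exact for
          them.\<close>
        have exact: "\<delta> k m = D k m \<tau>" if "1 \<le> m" "((k, m), (i, j)) \<in> R" for k m
        proof (rule D(3)[OF that(1) net])
          show "bounded_past R b' (k, m)"
            unfolding b'_def using past j that(2) by (rule bounded_past_update)
          show "\<beta> k m \<noteq> \<infinity>"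
            using finite_R[OF that(2)] initiation_finite_iff[OF that(1)] by simp
        qed
        \<comment> \<open>The actual causes form a candidate set on which every \<open>D\<close> is
          exact and at most \<alpha>, so this set attains the minimum.\<close>
        define A where "A = {(k, m) \<in> routed S i. m \<le> N \<and> \<delta> k m \<le> \<alpha> i j \<and> ((k, m), (i, j)) \<in> R}"
        have "A \<in> AA"
          using causal_R_truncated[OF j fin N] by (auto simp: AA_def A_def C_def)
        then have "F \<tau> \<le> max 0 (SUP (k, m)\<in>A. D k m \<tau>)" unfolding F_def by (rule INF_lower)
        also have "\<dots> \<le> \<alpha> i j"
        proof -
          have "D k m \<tau> \<le> \<alpha> i j" if "(k, m) \<in> A" for k m
            using that exact[of m k] by (auto simp: A_def routed_def)
          then show ?thesis using arrival_nonneg[OF j] by (auto intro!: SUP_least)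
        qed
        finally have "\<alpha> i j = F \<tau>" using \<open>\<alpha> i j \<le> F \<tau>\<close> by simp
        moreover have "\<delta> i (j - 1) = P \<tau>"
        proof (cases "j = 1")
          case False
          then have "((i, j - 1), (i, j)) \<in> R" using j fin by (intro step_R) auto
          then show ?thesis using False j exact[of "j - 1" i] by (simp add: P_def)
        qed (simp add: P_def departure_0)
        ultimately have "\<beta> i j = G \<tau>" using j by (simp add: initiation G_def)
        then show ?thesis using \<open>\<alpha> i j = F \<tau>\<close> j by (simp add: departure H_def)
      qed
      ultimately show ?thesis by blast
    qed
    then have "\<forall>\<tau> \<alpha> \<beta> \<delta> R. causal_network n S \<tau> \<alpha> \<beta> \<delta> R \<longrightarrow> \<delta> i j \<le> H \<tau> \<and>
      (bounded_past R b (i, j) \<and> \<beta> i j \<noteq> \<infinity> \<longrightarrow> \<alpha> i j = F \<tau> \<and> \<beta> i j = G \<tau> \<and> \<delta> i j = H \<tau>)"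
      by (intro allI impI)
    then show ?thesis
      by (rule bexI[of _ H, THEN bexI[of _ G], THEN bexI[of _ F]]) fact+
  qed
qed

theorem theorem2:
  fixes n :: "'l::finite \<Rightarrow> enat"
    and S :: "'l \<Rightarrow> nat \<Rightarrow> 'l"
  shows "\<forall>i. \<forall>j\<ge>1. \<exists>f\<in>max_min_plus. \<exists>g\<in>max_min_plus. \<exists>h\<in>max_min_plus.
    \<forall>(\<Theta> :: (real ^ 'd) set) (M :: 'w measure) (\<tau> :: real ^ 'd \<Rightarrow> 'w \<Rightarrow> 'l \<Rightarrow> nat \<Rightarrow> real)
      (\<alpha> :: real ^ 'd \<Rightarrow> 'w \<Rightarrow> 'l \<Rightarrow> nat \<Rightarrow> ereal) \<beta> \<delta>.
      prob_space M \<longrightarrow>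
      (\<forall>\<theta>\<in>\<Theta>. \<forall>k. \<forall>m\<ge>1. (\<lambda>\<omega>. \<tau> \<theta> \<omega> k m) \<in> borel_measurable M) \<longrightarrow>
      (\<forall>\<theta>\<in>\<Theta>. \<forall>\<omega>\<in>space M.
        queueing_network n S (\<tau> \<theta> \<omega>) (\<alpha> \<theta> \<omega>) (\<beta> \<theta> \<omega>) (\<delta> \<theta> \<omega>)) \<longrightarrow>
      (\<forall>\<theta>\<in>\<Theta>. \<forall>\<omega>\<in>space M. \<beta> \<theta> \<omega> i j \<noteq> \<infinity> \<longrightarrow>
        \<alpha> \<theta> \<omega> i j = ereal (f (\<tau> \<theta> \<omega>)) \<and>
        \<beta> \<theta> \<omega> i j = ereal (g (\<tau> \<theta> \<omega>)) \<and>
        \<delta> \<theta> \<omega> i j = ereal (h (\<tau> \<theta> \<omega>)))"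
proof (intro allI impI)
  fix i :: 'l and j :: nat
  assume j: "1 \<le> j"
  \<comment> \<open>With all bounds infinite, nothing is excluded by \<open>bounded_past\<close>, so
    the expressions are exact whenever the service occurs.\<close>
  obtain F G H where FGH: "F \<in> emax_min_plus" "G \<in> emax_min_plus" "H \<in> emax_min_plus"
    and eq: "\<And>\<tau> \<alpha> \<beta> \<delta> R. causal_network n S \<tau> \<alpha> \<beta> \<delta> R \<Longrightarrow> bounded_past R (\<lambda>_. \<infinity>) (i, j) \<Longrightarrow>
      \<beta> i j \<noteq> \<infinity> \<Longrightarrow> \<alpha> i j = F \<tau> \<and> \<beta> i j = G \<tau> \<and> \<delta> i j = H \<tau>"
    using truncated_representation[OF j, of n S i "\<lambda>_. \<infinity>"] by metis
  obtain f where f: "f \<in> max_min_plus" "\<And>T. F T \<noteq> \<infinity> \<Longrightarrow> F T = ereal (f T)"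
    using emax_min_plus_represents[OF FGH(1)] by blast
  obtain g where g: "g \<in> max_min_plus" "\<And>T. G T \<noteq> \<infinity> \<Longrightarrow> G T = ereal (g T)"
    using emax_min_plus_represents[OF FGH(2)] by blast
  obtain h where h: "h \<in> max_min_plus" "\<And>T. H T \<noteq> \<infinity> \<Longrightarrow> H T = ereal (h T)"
    using emax_min_plus_represents[OF FGH(3)] by blast
  \<comment> \<open>Since \<open>f\<close>, \<open>g\<close> and \<open>h\<close> are already fixed,
    it suffices to treat one realization of the service times at a time.\<close>
  have rep: "\<alpha> i j = ereal (f \<tau>) \<and> \<beta> i j = ereal (g \<tau>) \<and> \<delta> i j = ereal (h \<tau>)"
    if net: "queueing_network n S \<tau> \<alpha> \<beta> \<delta>" and fin: "\<beta> i j \<noteq> \<infinity>" for \<tau> \<alpha> \<beta> \<delta>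
  proof -
    interpret queueing_network n S \<tau> \<alpha> \<beta> \<delta> by (rule net)
    obtain R where "causal_network n S \<tau> \<alpha> \<beta> \<delta> R" using ex_causal_network by blast
    moreover have "bounded_past R (\<lambda>_. \<infinity>) (i, j)" by (simp add: bounded_past_def)
    ultimately have "\<alpha> i j = F \<tau> \<and> \<beta> i j = G \<tau> \<and> \<delta> i j = H \<tau>" using fin by (rule eq)
    moreover have "\<alpha> i j \<noteq> \<infinity>" using fin j initiation[of j i] by auto
    moreover have "\<delta> i j \<noteq> \<infinity>" using fin j initiation_finite_iff by blast
    ultimately show ?thesis using f(2) g(2) h(2) fin by metis
  qed
  show "\<exists>f\<in>max_min_plus. \<exists>g\<in>max_min_plus. \<exists>h\<in>max_min_plus.
    \<forall>(\<Theta> :: (real ^ 'd) set) (M :: 'w measure) (\<tau> :: real ^ 'd \<Rightarrow> 'w \<Rightarrow> 'l \<Rightarrow> nat \<Rightarrow> real)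
      (\<alpha> :: real ^ 'd \<Rightarrow> 'w \<Rightarrow> 'l \<Rightarrow> nat \<Rightarrow> ereal) \<beta> \<delta>.
      prob_space M \<longrightarrow>
      (\<forall>\<theta>\<in>\<Theta>. \<forall>k. \<forall>m\<ge>1. (\<lambda>\<omega>. \<tau> \<theta> \<omega> k m) \<in> borel_measurable M) \<longrightarrow>
      (\<forall>\<theta>\<in>\<Theta>. \<forall>\<omega>\<in>space M.
        queueing_network n S (\<tau> \<theta> \<omega>) (\<alpha> \<theta> \<omega>) (\<beta> \<theta> \<omega>) (\<delta> \<theta> \<omega>)) \<longrightarrow>
      (\<forall>\<theta>\<in>\<Theta>. \<forall>\<omega>\<in>space M. \<beta> \<theta> \<omega> i j \<noteq> \<infinity> \<longrightarrow>
        \<alpha> \<theta> \<omega> i j = ereal (f (\<tau> \<theta> \<omega>)) \<and>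
        \<beta> \<theta> \<omega> i j = ereal (g (\<tau> \<theta> \<omega>)) \<and>
        \<delta> \<theta> \<omega> i j = ereal (h (\<tau> \<theta> \<omega>)))"
    by (rule bexI[OF _ f(1)], rule bexI[OF _ g(1)], rule bexI[OF _ h(1)], intro allI impI ballI)
      (rule rep, blast)
qed

end
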